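(* Let $(\mathfrak{g},[~,~]_1,[~,~]_2,\alpha)$ be a compatible Hom-Lie algebra. Then the equivalence classes of infinitesimal deformations of it are in one-to-one correspondence with $H^2_{\mathrm{cHom}}(\mathfrak{g},\mathfrak{g})$, the second cohomology group with coefficients in the adjoint representation.
   Context: All vector spaces are over a field $\mathbb{K}$ of characteristic zero. A Hom-Lie algebra $(\mathfrak{g},[~,~],\alpha)$ is a vector space $\mathfrak{g}$ with a bilinear skew-symmetric bracket and a linear map $\alpha:\mathfrak{g}\to\mathfrak{g}$ such that $\alpha[x,y]=[\alpha(x),\alpha(y)]$ and $[[x,y],\alpha(z)]+[[y,z],\alpha(x)]+[[z,x],\alpha(y)]=0$ for all $x,y,z\in\mathfrak{g}$. A compatible Hom-Lie algebra $(\mathfrak{g},[~,~]_1,[~,~]_2,\alpha)$ consists of two Hom-Lie algebras $(\mathfrak{g},[~,~]_1,\alpha)$, $(\mathfrak{g},[~,~]_2,\alpha)$ such that $(\mathfrak{g},\lambda[~,~]_1+\eta[~,~]_2,\alpha)$ is a Hom-Lie algebra for all $\lambda,\eta\in\mathbb{K}$. The same definitions apply over a commutative $\mathbb{K}$-algebra in place of $\mathbb{K}$. A morphism of compatible Hom-Lie algebras is a linear map intertwining the twisting maps and preserving both brackets. Cohomology with adjoint coefficients: for $n\ge1$, $C^n_{\mathrm{Hom}}(\mathfrak{g},\mathfrak{g})=\{f:\wedge^n\mathfrak{g}\to\mathfrak{g}\text{ linear}\mid\alpha\circ f=f\circ\alpha^{\wedge n}\}$, and for $i=1,2$ $$({}^i\delta_{\mathrm{Hom}}f)(x_1,\ldots,x_{n+1})=\sum_{k=1}^{n+1}(-1)^{k+1}[\alpha^{n-1}(x_k),f(x_1,\ldots,\widehat{x_k},\ldots,x_{n+1})]_i+\sum_{1\le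 k<l\le n+1}(-1)^{k+l}f([x_k,x_l]_i,\alpha(x_1),\ldots,\widehat{\alpha(x_k)},\ldots,\widehat{\alpha(x_l)},\ldots,\alpha(x_{n+1})).$$ For $n\ge1$, $C^n_{\mathrm{cHom}}(\mathfrak{g},\mathfrak{g})=C^n_{\mathrm{Hom}}(\mathfrak{g},\mathfrak{g})^{\oplus n}$ and $\delta_{\mathrm{cHom}}(f_1,\ldots,f_n)=({}^1\delta_{\mathrm{Hom}}f_1,\ldots,{}^1\delta_{\mathrm{Hom}}f_i+{}^2\delta_{\mathrm{Hom}}f_{i-1},\ldots,{}^2\delta_{\mathrm{Hom}}f_n)$ (the middle entries in positions $2\le i\le n$). $H^2_{\mathrm{cHom}}(\mathfrak{g},\mathfrak{g})=\ker(\delta_{\mathrm{cHom}}:C^2_{\mathrm{cHom}}\to C^3_{\mathrm{cHom}})/\mathrm{Im}(\delta_{\mathrm{cHom}}:C^1_{\mathrm{cHom}}\to C^2_{\mathrm{cHom}})$. Infinitesimal deformations: an infinitesimal deformation of $\mathfrak{g}$ is a linear deformation over $\mathbb{K}[[t]]/(t^2)$, i.e. a pair $(\omega_1,\omega_2)\in C^2_{\mathrm{cHom}}(\mathfrak{g},\mathfrak{g})=C^2_{\mathrm{Hom}}(\mathfrak{g},\mathfrak{g})^{\oplus2}$ such that the brackets $[x,y]_i^t=[x,y]_i+t\,\omega_i(x,y)$, $i=1,2$, extended $\mathbb{K}[[t]]/(t^2)$-bilinearly, together with the $\mathbb{K}[[t]]/(t^2)$-linear extension of $\alpha$, make $\mathfrak{g}[[t]]/(t^2)$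 a compatible Hom-Lie algebra over $\mathbb{K}[[t]]/(t^2)$. Two infinitesimal deformations, generated by $(\omega_1,\omega_2)$ and $(\omega_1',\omega_2')$, are equivalent if there is a linear map $N:\mathfrak{g}\to\mathfrak{g}$ with $\alpha\circ N=N\circ\alpha$ such that $\mathrm{id}+tN$ is a morphism (over $\mathbb{K}[[t]]/(t^2)$) of compatible Hom-Lie algebras from the first to the second. *)

theory Defs
  imports
    "HOL-Computational_Algebra.Formal_Power_Series"
    "HOL-Library.Function_Algebras"
    "HOL-Library.Product_Plus"
begin

section \<open>Compatible Hom-Lie algebras\<close>

text \<open>The scalars range over an arbitrary commutative ring, since the notion is needed both over
  a field \<open>\<bbbK>\<close> and over \<open>\<bbbK>[[t]]/(t\<^sup>2)\<close>.\<close>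

locale hom_lie_algebra = module scale
  for scale :: "'r::comm_ring_1 \<Rightarrow> 'g::ab_group_add \<Rightarrow> 'g" +
  fixes br :: "'g \<Rightarrow> 'g \<Rightarrow> 'g" and \<alpha> :: "'g \<Rightarrow> 'g"
  assumes bracket_linear_right: "module_hom scale scale (\<lambda>y. br x y)"
    and bracket_linear_left: "module_hom scale scale (\<lambda>x. br x y)"
    and bracket_skew: "br x y = - br y x"
    and twist_linear: "module_hom scale scale \<alpha>"
    and twist_bracket: "\<alpha> (br x y) = br (\<alpha> x) (\<alpha> y)"
    and hom_jacobi: "br (br x y) (\<alpha> z) + br (br y z) (\<alpha> x) + br (br z x) (\<alpha> y) = 0"

locale compatible_hom_lie_algebra =
  first: hom_lie_algebra scale br1 \<alpha> + second: hom_lie_algebra scale br2 \<alpha>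
  for scale :: "'r::comm_ring_1 \<Rightarrow> 'g::ab_group_add \<Rightarrow> 'g"
    and br1 br2 :: "'g \<Rightarrow> 'g \<Rightarrow> 'g" and \<alpha> :: "'g \<Rightarrow> 'g" +
  assumes compatible:
    "hom_lie_algebra scale (\<lambda>x y. scale l (br1 x y) + scale m (br2 x y)) \<alpha>"

definition compatible_hom_lie_morphism ::
  "('r::comm_ring_1 \<Rightarrow> 'g::ab_group_add \<Rightarrow> 'g) \<Rightarrow> ('g \<Rightarrow> 'g \<Rightarrow> 'g) \<Rightarrow> ('g \<Rightarrow> 'g \<Rightarrow> 'g) \<Rightarrow> ('g \<Rightarrow> 'g) \<Rightarrow>
   ('r \<Rightarrow> 'h::ab_group_add \<Rightarrow> 'h) \<Rightarrow> ('h \<Rightarrow> 'h \<Rightarrow> 'h) \<Rightarrow> ('h \<Rightarrow> 'h \<Rightarrow> 'h) \<Rightarrow> ('h \<Rightarrow> 'h) \<Rightarrow>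
   ('g \<Rightarrow> 'h) \<Rightarrow> bool" where
  "compatible_hom_lie_morphism scale br1 br2 \<alpha> scale' br1' br2' \<alpha>' \<phi> \<longleftrightarrow>
     module_hom scale scale' \<phi> \<and>
     (\<forall>x. \<phi> (\<alpha> x) = \<alpha>' (\<phi> x)) \<and>
     (\<forall>x y. \<phi> (br1 x y) = br1' (\<phi> x) (\<phi> y)) \<and>
     (\<forall>x y. \<phi> (br2 x y) = br2' (\<phi> x) (\<phi> y))"

section \<open>Cohomology with adjoint coefficients\<close>

text \<open>A linear map on \<open>\<And>\<^sup>n \<gg>\<close> is an alternating multilinear map in \<open>n\<close> arguments. The arguments
  are given as a list of length \<open>n\<close>; lists of any other length are mapped to 0, so that
  equality of cochains is equality of functions.\<close>

definition hom_cochains ::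
  "('k::comm_ring_1 \<Rightarrow> 'g::ab_group_add \<Rightarrow> 'g) \<Rightarrow> ('g \<Rightarrow> 'g) \<Rightarrow> nat \<Rightarrow> ('g list \<Rightarrow> 'g) set" where
  "hom_cochains scale \<alpha> n = {f.
     (\<forall>xs i. length xs = n \<and> i < n \<longrightarrow> module_hom scale scale (\<lambda>v. f (xs[i := v]))) \<and>
     (\<forall>xs i j. length xs = n \<and> i < j \<and> j < n \<and> xs ! i = xs ! j \<longrightarrow> f xs = 0) \<and>
     (\<forall>xs. length xs = n \<longrightarrow> \<alpha> (f xs) = f (map \<alpha> xs)) \<and>
     (\<forall>xs. length xs \<noteq> n \<longrightarrow> f xs = 0)}"

definition omit :: "nat \<Rightarrow> 'a list \<Rightarrow> 'a list" where
  "omit k xs = take k xs @ drop (Suc k) xs"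

text \<open>List positions start at 0, hence the sign \<open>(-1)\<^sup>k\<close> in the first sum in place of
  \<open>(-1)\<^sup>k\<^sup>+\<^sup>1\<close>; the sign \<open>(-1)\<^sup>k\<^sup>+\<^sup>l\<close> in the second sum is unaffected. Since \<open>k < l\<close>, position \<open>l\<close> is
  removed first.\<close>

definition hom_delta ::
  "('k::comm_ring_1 \<Rightarrow> 'g::ab_group_add \<Rightarrow> 'g) \<Rightarrow> ('g \<Rightarrow> 'g \<Rightarrow> 'g) \<Rightarrow> ('g \<Rightarrow> 'g) \<Rightarrow> nat \<Rightarrow>
   ('g list \<Rightarrow> 'g) \<Rightarrow> 'g list \<Rightarrow> 'g" where
  "hom_delta scale br \<alpha> n f xs =
     (if length xs = n + 1 then
        (\<Sum>k<n+1. scale ((-1) ^ k) (br ((\<alpha> ^^ (n - 1)) (xs ! k)) (f (omit k xs)))) +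
        (\<Sum>(k, l) \<in> {(k, l). k < l \<and> l < n + 1}.
           scale ((-1) ^ (k + l)) (f (br (xs ! k) (xs ! l) # map \<alpha> (omit k (omit l xs)))))
      else 0)"

text \<open>An element \<open>(f\<^sub>1, \<dots>, f\<^sub>n)\<close> of the \<open>n\<close>-fold direct sum is a function on indices that vanishes
  outside \<open>{1..n}\<close>.\<close>

definition chom_cochains ::
  "('k::comm_ring_1 \<Rightarrow> 'g::ab_group_add \<Rightarrow> 'g) \<Rightarrow> ('g \<Rightarrow> 'g) \<Rightarrow> nat \<Rightarrow>
   (nat \<Rightarrow> 'g list \<Rightarrow> 'g) set" where
  "chom_cochains scale \<alpha> n =
     {f. (\<forall>i\<in>{1..n}. f i \<in> hom_cochains scale \<alpha> n) \<and> (\<forall>i. i \<notin> {1..n} \<longrightarrow> f i = 0)}"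

definition chom_delta ::
  "('k::comm_ring_1 \<Rightarrow> 'g::ab_group_add \<Rightarrow> 'g) \<Rightarrow> ('g \<Rightarrow> 'g \<Rightarrow> 'g) \<Rightarrow> ('g \<Rightarrow> 'g \<Rightarrow> 'g) \<Rightarrow> ('g \<Rightarrow> 'g) \<Rightarrow>
   nat \<Rightarrow> (nat \<Rightarrow> 'g list \<Rightarrow> 'g) \<Rightarrow> nat \<Rightarrow> 'g list \<Rightarrow> 'g" where
  "chom_delta scale br1 br2 \<alpha> n f i =
     (if i = 1 then hom_delta scale br1 \<alpha> n (f 1)
      else if 2 \<le> i \<and> i \<le> n then
        hom_delta scale br1 \<alpha> n (f i) + hom_delta scale br2 \<alpha> n (f (i - 1))
      else if i = n + 1 then hom_delta scale br2 \<alpha> n (f n)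
      else 0)"

definition chom_cocycles ::
  "('k::comm_ring_1 \<Rightarrow> 'g::ab_group_add \<Rightarrow> 'g) \<Rightarrow> ('g \<Rightarrow> 'g \<Rightarrow> 'g) \<Rightarrow> ('g \<Rightarrow> 'g \<Rightarrow> 'g) \<Rightarrow> ('g \<Rightarrow> 'g) \<Rightarrow>
   nat \<Rightarrow> (nat \<Rightarrow> 'g list \<Rightarrow> 'g) set" where
  "chom_cocycles scale br1 br2 \<alpha> n =
     {f \<in> chom_cochains scale \<alpha> n. chom_delta scale br1 br2 \<alpha> n f = 0}"

text \<open>Only meaningful for \<open>n \<ge> 2\<close>, as there are no cochains in degree 0 here.\<close>

definition chom_coboundaries ::
  "('k::comm_ring_1 \<Rightarrow> 'g::ab_group_add \<Rightarrow> 'g) \<Rightarrow> ('g \<Rightarrow> 'g \<Rightarrow> 'g) \<Rightarrow> ('g \<Rightarrow> 'g \<Rightarrow> 'g) \<Rightarrow> ('g \<Rightarrow> 'g) \<Rightarrow>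
   nat \<Rightarrow> (nat \<Rightarrow> 'g list \<Rightarrow> 'g) set" where
  "chom_coboundaries scale br1 br2 \<alpha> n =
     chom_delta scale br1 br2 \<alpha> (n - 1) ` chom_cochains scale \<alpha> (n - 1)"

definition cohomologous ::
  "('k::comm_ring_1 \<Rightarrow> 'g::ab_group_add \<Rightarrow> 'g) \<Rightarrow> ('g \<Rightarrow> 'g \<Rightarrow> 'g) \<Rightarrow> ('g \<Rightarrow> 'g \<Rightarrow> 'g) \<Rightarrow> ('g \<Rightarrow> 'g) \<Rightarrow>
   nat \<Rightarrow> ((nat \<Rightarrow> 'g list \<Rightarrow> 'g) \<times> (nat \<Rightarrow> 'g list \<Rightarrow> 'g)) set" where
  "cohomologous scale br1 br2 \<alpha> n =
     {(f, g). f \<in> chom_cocycles scale br1 br2 \<alpha> n \<and> g \<in> chom_cocycles scale br1 br2 \<alpha> n \<and>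
        f - g \<in> chom_coboundaries scale br1 br2 \<alpha> n}"

definition chom_cohomology ::
  "('k::comm_ring_1 \<Rightarrow> 'g::ab_group_add \<Rightarrow> 'g) \<Rightarrow> ('g \<Rightarrow> 'g \<Rightarrow> 'g) \<Rightarrow> ('g \<Rightarrow> 'g \<Rightarrow> 'g) \<Rightarrow> ('g \<Rightarrow> 'g) \<Rightarrow>
   nat \<Rightarrow> (nat \<Rightarrow> 'g list \<Rightarrow> 'g) set set" where
  "chom_cohomology scale br1 br2 \<alpha> n =
     chom_cocycles scale br1 br2 \<alpha> n // cohomologous scale br1 br2 \<alpha> n"

section \<open>The ring \<open>\<bbbK>[[t]]/(t\<^sup>2)\<close> and extension of scalars\<close>

definition fps_cong_t2 :: "'k::comm_ring_1 fps \<Rightarrow> 'k fps \<Rightarrow> bool" where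
  "fps_cong_t2 f g \<longleftrightarrow> fps_X ^ 2 dvd f - g"

lemma fps_cong_t2_iff: "fps_cong_t2 f g \<longleftrightarrow> fps_nth f 0 = fps_nth g 0 \<and> fps_nth f 1 = fps_nth g 1"
proof
  assume "fps_cong_t2 f g"
  then obtain h where h: "f - g = fps_X ^ 2 * h" by (auto simp: fps_cong_t2_def dvd_def)
  have "fps_nth (f - g) 0 = 0" "fps_nth (f - g) 1 = 0"
    unfolding h by (simp_all add: fps_X_power_mult_nth)
  then show "fps_nth f 0 = fps_nth g 0 \<and> fps_nth f 1 = fps_nth g 1" by simp
next
  assume *: "fps_nth f 0 = fps_nth g 0 \<and> fps_nth f 1 = fps_nth g 1"
  have "f - g = fps_X ^ 2 * fps_shift 2 (f - g)"
  proof (rule fps_ext)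
    fix n
    show "fps_nth (f - g) n = fps_nth (fps_X ^ 2 * fps_shift 2 (f - g)) n"
      using * by (cases "n < 2") (auto simp: fps_X_power_mult_nth less_2_cases_iff
          le_add_diff_inverse2 simp del: add_2_eq_Suc' add_2_eq_Suc)
  qed
  then show "fps_cong_t2 f g" unfolding fps_cong_t2_def by (rule dvdI)
qed

quotient_type (overloaded) 'k dual = "'k::comm_ring_1 fps" / fps_cong_t2
  by (rule equivpI) (auto simp: reflp_def symp_def transp_def fps_cong_t2_iff)

instantiation dual :: (comm_ring_1) comm_ring_1
begin

lift_definition zero_dual :: "'a dual" is 0 .
lift_definition one_dual :: "'a dual" is 1 .
lift_definition plus_dual :: "'a dual \<Rightarrow> 'a dual \<Rightarrow> 'a dual" is "(+)"
  by (simp add: fps_cong_t2_iff)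
lift_definition uminus_dual :: "'a dual \<Rightarrow> 'a dual" is uminus
  by (simp add: fps_cong_t2_iff)
lift_definition minus_dual :: "'a dual \<Rightarrow> 'a dual \<Rightarrow> 'a dual" is "(-)"
  by (simp add: fps_cong_t2_iff)
lift_definition times_dual :: "'a dual \<Rightarrow> 'a dual \<Rightarrow> 'a dual" is "(*)"
  by (simp add: fps_cong_t2_iff fps_mult_nth)

instance
  by standard (transfer; simp add: fps_cong_t2_iff fps_mult_nth algebra_simps)+

end

lift_definition dual_coeff0 :: "'k::comm_ring_1 dual \<Rightarrow> 'k" is "\<lambda>f. fps_nth f 0"
  by (simp add: fps_cong_t2_iff)
lift_definition dual_coeff1 :: "'k::comm_ring_1 dual \<Rightarrow> 'k" is "\<lambda>f. fps_nth f 1"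
  by (simp add: fps_cong_t2_iff)
lift_definition dual_const :: "'k::comm_ring_1 \<Rightarrow> 'k dual" is fps_const .
lift_definition dual_t :: "'k::comm_ring_1 dual" is fps_X .

text \<open>The pair \<open>(x, y)\<close> stands for the element \<open>x + t y\<close> of \<open>\<gg>[[t]]/(t\<^sup>2)\<close>.\<close>

definition dual_scale ::
  "('k::comm_ring_1 \<Rightarrow> 'g::ab_group_add \<Rightarrow> 'g) \<Rightarrow> 'k dual \<Rightarrow> 'g \<times> 'g \<Rightarrow> 'g \<times> 'g" where
  "dual_scale scale c = (\<lambda>(x, y). (scale (dual_coeff0 c) x,
     scale (dual_coeff0 c) y + scale (dual_coeff1 c) x))"

text \<open>The \<open>\<bbbK>[[t]]/(t\<^sup>2)\<close>-bilinear extension of \<open>(x, y) \<mapsto> [x, y] + t \<omega>(x, y)\<close>; it is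
  characterised by \<open>deformed_bracket_unique\<close> below.\<close>

definition deformed_bracket ::
  "('g::ab_group_add \<Rightarrow> 'g \<Rightarrow> 'g) \<Rightarrow> ('g list \<Rightarrow> 'g) \<Rightarrow> 'g \<times> 'g \<Rightarrow> 'g \<times> 'g \<Rightarrow> 'g \<times> 'g" where
  "deformed_bracket br \<omega> = (\<lambda>(x, y) (x', y'). (br x x', br x y' + br y x' + \<omega> [x, x']))"

lemma dual_coeff_simps [simp]:
  "dual_coeff0 (a + b) = dual_coeff0 a + dual_coeff0 b"
  "dual_coeff1 (a + b) = dual_coeff1 a + dual_coeff1 b"
  "dual_coeff0 (a * b) = dual_coeff0 a * dual_coeff0 b"
  "dual_coeff1 (a * b) = dual_coeff0 a * dual_coeff1 b + dual_coeff1 a * dual_coeff0 b"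
  "dual_coeff0 1 = 1" "dual_coeff1 1 = 0"
  "dual_coeff0 (dual_const c) = c" "dual_coeff1 (dual_const c) = 0"
  "dual_coeff0 dual_t = 0" "dual_coeff1 dual_t = 1"
  by (transfer; simp add: fps_mult_nth)+

lemma module_dual_scale:
  assumes "module scale"
  shows "module (dual_scale scale)"
proof -
  interpret module scale by fact
  show ?thesis
    by standard (auto simp: dual_scale_def scale_right_distrib scale_left_distrib algebra_simps)
qed

lemma dual_scale_decompose:
  assumes "module scale"
  shows "(x, y) = (x, 0) + dual_scale scale dual_t (y, 0)"
proof -
  interpret module scale by fact
  show ?thesis by (simp add: dual_scale_def)
qed

lemma deformed_bracket_bilinear:
  assumes "hom_lie_algebra scale br \<alpha>" and "\<omega> \<in> hom_cochains scale \<alpha> 2"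
  shows "module_hom (dual_scale scale) (dual_scale scale) (deformed_bracket br \<omega> u)"
    and "module_hom (dual_scale scale) (dual_scale scale) (\<lambda>u. deformed_bracket br \<omega> u v)"
proof -
  interpret hom_lie_algebra scale br \<alpha> by fact
  note d = module_dual_scale[OF module_axioms]
  have w: "module_hom scale scale (\<lambda>v. \<omega> (xs[i := v]))" if "length xs = 2" "i < 2" for xs i
    using assms(2) that by (auto simp: hom_cochains_def)
  have w1: "module_hom scale scale (\<lambda>v. \<omega> [x, v])" for x
    using w[of "[x, x]" 1] by simp
  have w0: "module_hom scale scale (\<lambda>v. \<omega> [v, x])" for x
    using w[of "[x, x]" 0] by simp
  note s = module_hom.add[OF w1] module_hom.add[OF w0] module_hom.scale[OF w1] module_hom.scale[OF w0]
    module_hom.add[OF bracket_linear_left] module_hom.add[OF bracket_linear_right]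
    module_hom.scale[OF bracket_linear_left] module_hom.scale[OF bracket_linear_right]
  show "module_hom (dual_scale scale) (dual_scale scale) (deformed_bracket br \<omega> u)"
    by (intro module_hom.intro module_hom_axioms.intro d)
      (auto simp: deformed_bracket_def dual_scale_def s scale_right_distrib split: prod.splits)
  show "module_hom (dual_scale scale) (dual_scale scale) (\<lambda>u. deformed_bracket br \<omega> u v)"
    by (intro module_hom.intro module_hom_axioms.intro d)
      (auto simp: deformed_bracket_def dual_scale_def s scale_right_distrib split: prod.splits)
qed

lemma deformed_bracket_unique:
  assumes "hom_lie_algebra scale br \<alpha>" and "\<omega> \<in> hom_cochains scale \<alpha> 2"
    and lin: "\<And>u. module_hom (dual_scale scale) (dual_scale scale) (B u)"
      "\<And>v. module_hom (dual_scale scale) (dual_scale scale) (\<lambda>u. B u v)"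
    and base: "\<And>x y. B (x, 0) (y, 0) = (br x y, 0) + dual_scale scale dual_t (\<omega> [x, y], 0)"
  shows "B = deformed_bracket br \<omega>"
proof (intro ext, clarify)
  fix x y x' y'
  interpret hom_lie_algebra scale br \<alpha> by fact
  note D = dual_scale_decompose[OF module_axioms]
  have "B (x, y) (x', y') =
      B ((x, 0) + dual_scale scale dual_t (y, 0)) ((x', 0) + dual_scale scale dual_t (y', 0))"
    by (simp only: D[symmetric])
  also have "\<dots> = B (x, 0) (x', 0) + dual_scale scale dual_t (B (x, 0) (y', 0))
     + dual_scale scale dual_t (B (y, 0) (x', 0))
     + dual_scale scale dual_t (dual_scale scale dual_t (B (y, 0) (y', 0)))"
    by (simp add: module_hom.add[OF lin(1)] module_hom.add[OF lin(2)] module_hom.scale[OF lin(1)]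
        module_hom.scale[OF lin(2)] module.scale_right_distrib[OF module_dual_scale[OF module_axioms]]
        del: add_Pair)
  also have "\<dots> = deformed_bracket br \<omega> (x, y) (x', y')"
    unfolding base by (simp add: dual_scale_def deformed_bracket_def)
  finally show "B (x, y) (x', y') = deformed_bracket br \<omega> (x, y) (x', y')" .
qed

section \<open>Infinitesimal deformations\<close>

text \<open>\<open>map_prod \<alpha> \<alpha>\<close> is the \<open>\<bbbK>[[t]]/(t\<^sup>2)\<close>-linear extension \<open>x + t y \<mapsto> \<alpha> x + t \<alpha> y\<close> of \<open>\<alpha>\<close>.\<close>

definition infinitesimal_deformations ::
  "('k::comm_ring_1 \<Rightarrow> 'g::ab_group_add \<Rightarrow> 'g) \<Rightarrow> ('g \<Rightarrow> 'g \<Rightarrow> 'g) \<Rightarrow> ('g \<Rightarrow> 'g \<Rightarrow> 'g) \<Rightarrow> ('g \<Rightarrow> 'g) \<Rightarrow>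
   (nat \<Rightarrow> 'g list \<Rightarrow> 'g) set" where
  "infinitesimal_deformations scale br1 br2 \<alpha> =
     {\<omega> \<in> chom_cochains scale \<alpha> 2.
        compatible_hom_lie_algebra (dual_scale scale)
          (deformed_bracket br1 (\<omega> 1)) (deformed_bracket br2 (\<omega> 2)) (map_prod \<alpha> \<alpha>)}"

text \<open>\<open>\<lambda>(x, y). (x, y + N x)\<close> is \<open>id + t N\<close>.\<close>

definition equivalent_deformations ::
  "('k::comm_ring_1 \<Rightarrow> 'g::ab_group_add \<Rightarrow> 'g) \<Rightarrow> ('g \<Rightarrow> 'g \<Rightarrow> 'g) \<Rightarrow> ('g \<Rightarrow> 'g \<Rightarrow> 'g) \<Rightarrow> ('g \<Rightarrow> 'g) \<Rightarrow>
   ((nat \<Rightarrow> 'g list \<Rightarrow> 'g) \<times> (nat \<Rightarrow> 'g list \<Rightarrow> 'g)) set" where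
  "equivalent_deformations scale br1 br2 \<alpha> =
     {(\<omega>, \<omega>'). \<omega> \<in> infinitesimal_deformations scale br1 br2 \<alpha> \<and>
        \<omega>' \<in> infinitesimal_deformations scale br1 br2 \<alpha> \<and>
        (\<exists>N. module_hom scale scale N \<and> \<alpha> \<circ> N = N \<circ> \<alpha> \<and>
           compatible_hom_lie_morphism
             (dual_scale scale) (deformed_bracket br1 (\<omega> 1)) (deformed_bracket br2 (\<omega> 2)) (map_prod \<alpha> \<alpha>)
             (dual_scale scale) (deformed_bracket br1 (\<omega>' 1)) (deformed_bracket br2 (\<omega>' 2)) (map_prod \<alpha> \<alpha>)
             (\<lambda>(x, y). (x, y + N x)))}"

end

theory Submission
  imports Defs
begin

text \<open>
  Deformations and cocycles are the same pairs of cochains, and equivalence of deformations and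
  being cohomologous are the same relation on them; the correspondence of classes is therefore the
  identity. Both coincidences come from comparing coefficients of \<open>t\<close>.

  For the first, write \<open>J(b, c)\<close> for the cyclic sum of \<open>b (c x y) (\<alpha> z)\<close>; on bilinear maps it is
  additive in \<open>b\<close> and in \<open>c\<close>. The Hom-Jacobi identity for \<open>br\<close> is \<open>J(br, br) = 0\<close>, and a pair of Hom-Lie brackets is
  compatible exactly when \<open>J(br1, br2) + J(br2, br1) = 0\<close>, because this is the only mixed term in
  the expansion of the identity for \<open>l br1 + m br2\<close> (\<open>compatible_hom_lie_algebra_iff\<close>). In degree 2,
  the coboundary of \<open>\<omega>\<close> is \<open>- (J(br, \<omega>) + J(\<omega>, br))\<close> (\<open>hom_delta_2\<close>). For the brackets
  \<open>br\<^sub>i + t \<omega>\<^sub>i\<close>, the constant terms of the three identities hold by assumption, and the \<open>t\<close>-terms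
  say that \<open>\<delta>\<^sub>1 \<omega>\<^sub>1\<close>, \<open>\<delta>\<^sub>2 \<omega>\<^sub>2\<close> and \<open>\<delta>\<^sub>1 \<omega>\<^sub>2 + \<delta>\<^sub>2 \<omega>\<^sub>1\<close> vanish. These are the three
  components of the cocycle condition (\<open>infinitesimal_deformations_eq_cocycles\<close>).

  For the second, the \<open>t\<close>-term of the condition that \<open>id + t N\<close> preserves the \<open>i\<close>-th brackets is
  \<open>\<omega>\<^sub>i(x, y) + N [x, y]\<^sub>i = [x, N y]\<^sub>i + [N x, y]\<^sub>i + \<omega>'\<^sub>i(x, y)\<close>, that is \<open>\<omega>\<^sub>i - \<omega>'\<^sub>i = \<delta>\<^sub>i N\<close>. The
  linear maps that commute with \<open>\<alpha>\<close> are the 1-cochains, so such an \<open>N\<close> exists for both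
  brackets at once exactly when the difference is a coboundary (\<open>equivalent_deformations_iff\<close>,
  \<open>cohomologous_iff\<close>).
\<close>

section \<open>Compatibility as a polarised Jacobi identity\<close>

text \<open>The Hom-Jacobi expression, with the two occurrences of the bracket made independent,
  so that a cochain can be put in either place.\<close>

definition jacobi_pairing ::
  "('g::ab_group_add \<Rightarrow> 'g \<Rightarrow> 'g) \<Rightarrow> ('g \<Rightarrow> 'g \<Rightarrow> 'g) \<Rightarrow> ('g \<Rightarrow> 'g) \<Rightarrow> 'g \<Rightarrow> 'g \<Rightarrow> 'g \<Rightarrow> 'g" where
  "jacobi_pairing b c \<alpha> x y z = b (c x y) (\<alpha> z) + b (c y z) (\<alpha> x) + b (c z x) (\<alpha> y)"

context hom_lie_algebra
begin

lemmas bracket_simps =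
  module_hom.add[OF bracket_linear_left] module_hom.add[OF bracket_linear_right]
  module_hom.scale[OF bracket_linear_left] module_hom.scale[OF bracket_linear_right]
  module_hom.zero[OF bracket_linear_left] module_hom.zero[OF bracket_linear_right]

lemmas twist_simps =
  module_hom.add[OF twist_linear] module_hom.scale[OF twist_linear] module_hom.zero[OF twist_linear]

lemma jacobi_pairing_self: "jacobi_pairing br br \<alpha> x y z = 0"
  by (simp add: jacobi_pairing_def hom_jacobi)

end

text \<open>The expansion has coefficients \<open>l\<^sup>2\<close>, \<open>m\<^sup>2\<close> and \<open>l m\<close>; the two pure terms vanish by the
  Hom-Jacobi identities of the summands.\<close>

lemma jacobi_pairing_combination:
  assumes "hom_lie_algebra scale b1 \<alpha>" and "hom_lie_algebra scale b2 \<alpha>"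
  defines "c l m \<equiv> (\<lambda>x y. scale l (b1 x y) + scale m (b2 x y))"
  shows "jacobi_pairing (c l m) (c l m) \<alpha> x y z =
    scale (l * m) (jacobi_pairing b1 b2 \<alpha> x y z + jacobi_pairing b2 b1 \<alpha> x y z)"
proof -
  interpret b1: hom_lie_algebra scale b1 \<alpha> by fact
  interpret b2: hom_lie_algebra scale b2 \<alpha> by fact
  have "jacobi_pairing (c l m) (c l m) \<alpha> x y z =
      scale (l * l) (jacobi_pairing b1 b1 \<alpha> x y z) +
      scale (m * m) (jacobi_pairing b2 b2 \<alpha> x y z) +
      scale (l * m) (jacobi_pairing b1 b2 \<alpha> x y z + jacobi_pairing b2 b1 \<alpha> x y z)"
    by (simp add: c_def jacobi_pairing_def b1.bracket_simps b2.bracket_simps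
        b1.scale_right_distrib mult.commute add_ac)
  then show ?thesis
    by (simp add: b1.jacobi_pairing_self b2.jacobi_pairing_self)
qed

text \<open>Compatibility quantifies over all coefficients, but the combination with \<open>l = m = 1\<close> already
  forces the mixed term to vanish, and then every other combination is a Hom-Lie bracket.\<close>

lemma compatible_hom_lie_algebra_iff:
  "compatible_hom_lie_algebra scale b1 b2 \<alpha> \<longleftrightarrow>
     hom_lie_algebra scale b1 \<alpha> \<and> hom_lie_algebra scale b2 \<alpha> \<and>
     (\<forall>x y z. jacobi_pairing b1 b2 \<alpha> x y z + jacobi_pairing b2 b1 \<alpha> x y z = 0)"
    (is "?L \<longleftrightarrow> ?b1 \<and> ?b2 \<and> ?mixed")
proof (intro iffI conjI)
  assume ?L
  then interpret compatible_hom_lie_algebra scale b1 b2 \<alpha> .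
  show ?b1 ?b2 by (rule first.hom_lie_algebra_axioms second.hom_lie_algebra_axioms)+
  show ?mixed
    using hom_lie_algebra.jacobi_pairing_self[OF compatible[of 1 1]]
      jacobi_pairing_combination[OF \<open>?b1\<close> \<open>?b2\<close>, of 1 1]
    by simp
next
  assume *: "?b1 \<and> ?b2 \<and> ?mixed"
  interpret b1: hom_lie_algebra scale b1 \<alpha> using * by simp
  interpret b2: hom_lie_algebra scale b2 \<alpha> using * by simp
  interpret pair: module_pair scale scale by unfold_locales
  have comb: "hom_lie_algebra scale (\<lambda>x y. scale l (b1 x y) + scale m (b2 x y)) \<alpha>" for l m
  proof (intro hom_lie_algebra.intro hom_lie_algebra_axioms.intro b1.module_axioms)
    fix x y z
    let ?c = "\<lambda>x y. scale l (b1 x y) + scale m (b2 x y)"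
    show "module_hom scale scale (?c x)" "module_hom scale scale (\<lambda>x. ?c x y)"
      by (intro pair.module_hom_add pair.module_hom_scale b1.bracket_linear_left
          b1.bracket_linear_right b2.bracket_linear_left b2.bracket_linear_right)+
    show "?c x y = - ?c y x"
      by (subst b1.bracket_skew, subst b2.bracket_skew) simp
    show "module_hom scale scale \<alpha>" by (rule b1.twist_linear)
    show "\<alpha> (?c x y) = ?c (\<alpha> x) (\<alpha> y)"
      by (simp add: b1.twist_simps b1.twist_bracket b2.twist_bracket)
    show "?c (?c x y) (\<alpha> z) + ?c (?c y z) (\<alpha> x) + ?c (?c z x) (\<alpha> y) = 0"
      using jacobi_pairing_combination[OF b1.hom_lie_algebra_axioms b2.hom_lie_algebra_axioms,
          of l m x y z] *
      by (simp add: jacobi_pairing_def)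
  qed
  show ?L
    by (intro compatible_hom_lie_algebra.intro compatible_hom_lie_algebra_axioms.intro
        b1.hom_lie_algebra_axioms b2.hom_lie_algebra_axioms comb)
qed

section \<open>Cochains in low degrees\<close>

lemma hom_cochains_2:
  assumes "\<omega> \<in> hom_cochains scale \<alpha> 2"
  shows "module_hom scale scale (\<lambda>v. \<omega> [v, x])" and "module_hom scale scale (\<lambda>v. \<omega> [x, v])"
    and "\<omega> [x, x] = 0" and "\<omega> [x, y] = - \<omega> [y, x]" and "\<alpha> (\<omega> [x, y]) = \<omega> [\<alpha> x, \<alpha> y]"
proof -
  have lin: "module_hom scale scale (\<lambda>v. \<omega> (xs[i := v]))" if "length xs = 2" "i < 2" for xs i
    using assms that by (auto simp: hom_cochains_def)
  show l: "module_hom scale scale (\<lambda>v. \<omega> [v, x])" for x using lin[of "[x, x]" 0] by simp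
  show r: "module_hom scale scale (\<lambda>v. \<omega> [x, v])" for x using lin[of "[x, x]" 1] by simp
  show alt: "\<omega> [x, x] = 0" for x
  proof -
    have "\<forall>xs i j. length xs = 2 \<and> i < j \<and> j < 2 \<and> xs ! i = xs ! j \<longrightarrow> \<omega> xs = 0"
      using assms by (simp add: hom_cochains_def)
    from this[rule_format, of "[x, x]" 0 1] show ?thesis by simp
  qed
  have "\<omega> [x + y, x + y] = \<omega> [x, x] + \<omega> [y, x] + (\<omega> [x, y] + \<omega> [y, y])"
    by (simp only: module_hom.add[OF l] module_hom.add[OF r])
  then show "\<omega> [x, y] = - \<omega> [y, x]" by (simp add: alt eq_neg_iff_add_eq_0 add.commute)
  show "\<alpha> (\<omega> [x, y]) = \<omega> [\<alpha> x, \<alpha> y]" using assms by (simp add: hom_cochains_def)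
qed

text \<open>Cochains, and families of cochains, are extended by zero; comparing them reduces to comparing
  values where they can be nonzero.\<close>

lemma eq_iff_eq_on:
  assumes "\<And>i. i \<notin> A \<Longrightarrow> f i = g i"
  shows "f = g \<longleftrightarrow> (\<forall>i\<in>A. f i = g i)"
  using assms by blast

lemma all_lists_length_2_3:
  "(\<forall>xs. length xs = 2 \<longrightarrow> P xs) \<longleftrightarrow> (\<forall>x y. P [x, y])"
  "(\<forall>xs. length xs = 3 \<longrightarrow> P xs) \<longleftrightarrow> (\<forall>x y z. P [x, y, z])"
  by (auto simp: numeral_eq_Suc length_Suc_conv)

lemma hom_cochains_1_iff:
  "f \<in> hom_cochains scale \<alpha> 1 \<longleftrightarrow>
     module_hom scale scale (\<lambda>x. f [x]) \<and> (\<forall>x. \<alpha> (f [x]) = f [\<alpha> x]) \<and>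
     (\<forall>xs. length xs \<noteq> 1 \<longrightarrow> f xs = 0)"
  by (auto simp: hom_cochains_def length_Suc_conv)

context hom_lie_algebra
begin

lemma hom_delta_1:
  "hom_delta scale br \<alpha> 1 f [x, y] = br x (f [y]) + br (f [x]) y - f [br x y]"
proof -
  have "{(k::nat, l). k < l \<and> l < 2} = {(0, 1)}" by auto
  then show ?thesis
    by (simp add: hom_delta_def omit_def numeral_eq_Suc bracket_skew[of y])
qed

text \<open>The six terms of the coboundary are those of the two cyclic sums after turning around the
  brackets \<open>[\<alpha> x\<^sub>k, \<omega>(\<dots>)]\<close> and reordering arguments by skew-symmetry.\<close>

lemma hom_delta_2:
  assumes "\<omega> \<in> hom_cochains scale \<alpha> 2"
  shows "hom_delta scale br \<alpha> 2 \<omega> [x, y, z] =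
    - (jacobi_pairing br (\<lambda>x y. \<omega> [x, y]) \<alpha> x y z + jacobi_pairing (\<lambda>x y. \<omega> [x, y]) br \<alpha> x y z)"
proof -
  have 1: "{(k::nat, l). k < l \<and> l < Suc (Suc (Suc 0))} = {(0, 1), (0, 2), (1, 2)}"
    by auto
  have 2: "br z x = - br x z" "\<omega> [z, x] = - \<omega> [x, z]"
    by (rule bracket_skew hom_cochains_2(4)[OF assms])+
  have 3: "br (\<alpha> u) v = - br v (\<alpha> u)" for u v by (rule bracket_skew)
  show ?thesis
    by (simp add: hom_delta_def omit_def 1 2 3 jacobi_pairing_def numeral_eq_Suc lessThan_Suc
        module_hom.neg[OF hom_cochains_2(1)[OF assms]] module_hom.neg[OF bracket_linear_left])
qed

end

lemma ternary_eq_0_iff: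
  assumes "\<And>xs. length xs \<noteq> 3 \<Longrightarrow> h xs = 0"
  shows "h = 0 \<longleftrightarrow> (\<forall>x y z. h [x, y, z] = 0)"
proof -
  have "h = 0 \<longleftrightarrow> (\<forall>xs. length xs = 3 \<longrightarrow> h xs = 0)"
    using eq_iff_eq_on[of "{xs. length xs = 3}" h 0] assms by simp
  then show ?thesis by (simp only: all_lists_length_2_3)
qed

lemma hom_delta_2_degree: "length xs \<noteq> 3 \<Longrightarrow> hom_delta scale br \<alpha> 2 \<omega> xs = 0"
  by (simp add: hom_delta_def)

section \<open>Infinitesimal deformations are 2-cocycles\<close>

text \<open>The product rule for the coefficient of \<open>t\<close>: it collects the terms in which \<open>t\<close> comes from one of
  the three arguments, from \<open>\<omega>2\<close> or from \<open>\<omega>1\<close>. The terms from the arguments vanish wherever the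
  constant coefficient vanishes identically.\<close>

lemma jacobi_pairing_deformed:
  assumes "hom_lie_algebra scale b1 \<alpha>" and "hom_lie_algebra scale b2 \<alpha>"
  shows "jacobi_pairing (deformed_bracket b1 \<omega>1) (deformed_bracket b2 \<omega>2) (map_prod \<alpha> \<alpha>)
      (x, x') (y, y') (z, z') =
    (jacobi_pairing b1 b2 \<alpha> x y z,
     jacobi_pairing b1 b2 \<alpha> x' y z + jacobi_pairing b1 b2 \<alpha> x y' z + jacobi_pairing b1 b2 \<alpha> x y z' +
     (jacobi_pairing b1 (\<lambda>x y. \<omega>2 [x, y]) \<alpha> x y z + jacobi_pairing (\<lambda>x y. \<omega>1 [x, y]) b2 \<alpha> x y z))"
proof -
  interpret b1: hom_lie_algebra scale b1 \<alpha> by fact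
  show ?thesis
    by (simp add: jacobi_pairing_def deformed_bracket_def b1.bracket_simps add_ac)
qed

lemma hom_lie_algebra_deformed_iff:
  assumes "hom_lie_algebra scale br \<alpha>" and \<omega>: "\<omega> \<in> hom_cochains scale \<alpha> 2"
  shows "hom_lie_algebra (dual_scale scale) (deformed_bracket br \<omega>) (map_prod \<alpha> \<alpha>) \<longleftrightarrow>
    hom_delta scale br \<alpha> 2 \<omega> = 0" (is "?L \<longleftrightarrow> ?R")
proof -
  interpret hom_lie_algebra scale br \<alpha> by fact
  have J: "jacobi_pairing (deformed_bracket br \<omega>) (deformed_bracket br \<omega>) (map_prod \<alpha> \<alpha>)
      (x, x') (y, y') (z, z') = (0, - hom_delta scale br \<alpha> 2 \<omega> [x, y, z])" for x x' y y' z z'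
    by (simp add: jacobi_pairing_deformed[OF assms(1,1)] jacobi_pairing_self hom_delta_2[OF \<omega>])
  show ?thesis
  proof
    assume ?L
    then show ?R
      using hom_lie_algebra.jacobi_pairing_self[OF \<open>?L\<close>, of "(_, 0)" "(_, 0)" "(_, 0)"]
      by (simp add: J ternary_eq_0_iff[OF hom_delta_2_degree] zero_prod_def)
  next
    assume ?R
    interpret dual: module "dual_scale scale" by (rule module_dual_scale) (rule module_axioms)
    show ?L
    proof (intro hom_lie_algebra.intro hom_lie_algebra_axioms.intro dual.module_axioms)
      fix u v w
      show "module_hom (dual_scale scale) (dual_scale scale) (deformed_bracket br \<omega> u)"
        "module_hom (dual_scale scale) (dual_scale scale) (\<lambda>u. deformed_bracket br \<omega> u v)"
        by (rule deformed_bracket_bilinear[OF assms])+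
      have "deformed_bracket br \<omega> (x, x') (y, y') = - deformed_bracket br \<omega> (y, y') (x, x')"
        for x x' y y'
        using bracket_skew[of x y] bracket_skew[of x y'] bracket_skew[of x' y]
          hom_cochains_2(4)[OF \<omega>, of x y]
        by (simp add: deformed_bracket_def)
      then show "deformed_bracket br \<omega> u v = - deformed_bracket br \<omega> v u"
        by (metis surj_pair)
      show "module_hom (dual_scale scale) (dual_scale scale) (map_prod \<alpha> \<alpha>)"
        by unfold_locales (auto simp: dual_scale_def twist_simps)
      show "map_prod \<alpha> \<alpha> (deformed_bracket br \<omega> u v) =
          deformed_bracket br \<omega> (map_prod \<alpha> \<alpha> u) (map_prod \<alpha> \<alpha> v)"
        by (cases u, cases v)
          (simp add: deformed_bracket_def twist_simps twist_bracket hom_cochains_2(5)[OF \<omega>])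
      show "deformed_bracket br \<omega> (deformed_bracket br \<omega> u v) (map_prod \<alpha> \<alpha> w) +
          deformed_bracket br \<omega> (deformed_bracket br \<omega> v w) (map_prod \<alpha> \<alpha> u) +
          deformed_bracket br \<omega> (deformed_bracket br \<omega> w u) (map_prod \<alpha> \<alpha> v) = 0"
        using J[of "fst u" "snd u" "fst v" "snd v" "fst w" "snd w"] \<open>?R\<close>
        unfolding jacobi_pairing_def by (simp add: zero_prod_def)
    qed
  qed
qed

text \<open>The Hom-Jacobi identities of the two deformed brackets give the outer components of the cocycle
  condition; the mixed term of compatibility gives the middle one.\<close>

lemma infinitesimal_deformations_eq_cocycles:
  assumes "compatible_hom_lie_algebra scale br1 br2 \<alpha>"
  shows "infinitesimal_deformations scale br1 br2 \<alpha> = chom_cocycles scale br1 br2 \<alpha> 2"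
proof -
  interpret compatible_hom_lie_algebra scale br1 br2 \<alpha> by fact
  note ax = first.hom_lie_algebra_axioms second.hom_lie_algebra_axioms
  have mixed0: "jacobi_pairing br1 br2 \<alpha> x y z = - jacobi_pairing br2 br1 \<alpha> x y z" for x y z
    using assms by (simp add: compatible_hom_lie_algebra_iff eq_neg_iff_add_eq_0)
  have "compatible_hom_lie_algebra (dual_scale scale)
      (deformed_bracket br1 (\<omega> 1)) (deformed_bracket br2 (\<omega> 2)) (map_prod \<alpha> \<alpha>) \<longleftrightarrow>
      chom_delta scale br1 br2 \<alpha> 2 \<omega> = 0" if "\<omega> \<in> chom_cochains scale \<alpha> 2" for \<omega>
  proof -
    have \<omega>: "\<omega> 1 \<in> hom_cochains scale \<alpha> 2" "\<omega> 2 \<in> hom_cochains scale \<alpha> 2"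
      using that by (auto simp: chom_cochains_def)
    let ?B1 = "deformed_bracket br1 (\<omega> 1)" and ?B2 = "deformed_bracket br2 (\<omega> 2)"
    let ?h = "hom_delta scale br1 \<alpha> 2 (\<omega> 2) + hom_delta scale br2 \<alpha> 2 (\<omega> 1)"
    have J: "jacobi_pairing ?B1 ?B2 (map_prod \<alpha> \<alpha>) (x, x') (y, y') (z, z') +
        jacobi_pairing ?B2 ?B1 (map_prod \<alpha> \<alpha>) (x, x') (y, y') (z, z') = (0, - ?h [x, y, z])"
      for x x' y y' z z'
      by (simp add: jacobi_pairing_deformed[OF ax] jacobi_pairing_deformed[OF ax(2,1)] mixed0
          first.hom_delta_2[OF \<omega>(2)] second.hom_delta_2[OF \<omega>(1)] del: One_nat_def)
    have "(\<forall>u v w. jacobi_pairing ?B1 ?B2 (map_prod \<alpha> \<alpha>) u v w +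
        jacobi_pairing ?B2 ?B1 (map_prod \<alpha> \<alpha>) u v w = 0) \<longleftrightarrow> (\<forall>x y z. ?h [x, y, z] = 0)"
      by (simp only: split_paired_All J) (simp only: zero_prod_def prod.inject neg_equal_0_iff_equal, simp)
    also have "\<dots> \<longleftrightarrow> ?h = 0"
      by (rule ternary_eq_0_iff[symmetric]) (simp add: hom_delta_2_degree)
    finally have mixed: "(\<forall>u v w. jacobi_pairing ?B1 ?B2 (map_prod \<alpha> \<alpha>) u v w +
        jacobi_pairing ?B2 ?B1 (map_prod \<alpha> \<alpha>) u v w = 0) \<longleftrightarrow> ?h = 0" .
    have "chom_delta scale br1 br2 \<alpha> 2 \<omega> = 0 \<longleftrightarrow>
        (\<forall>i\<in>{1, 2, 3}. chom_delta scale br1 br2 \<alpha> 2 \<omega> i = (0 :: nat \<Rightarrow> _) i)"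
      by (rule eq_iff_eq_on) (auto simp: chom_delta_def)
    also have "\<dots> \<longleftrightarrow> hom_delta scale br1 \<alpha> 2 (\<omega> 1) = 0 \<and> hom_delta scale br2 \<alpha> 2 (\<omega> 2) = 0 \<and> ?h = 0"
      by (auto simp: chom_delta_def)
    finally show ?thesis
      unfolding compatible_hom_lie_algebra_iff hom_lie_algebra_deformed_iff[OF ax(1) \<omega>(1)]
        hom_lie_algebra_deformed_iff[OF ax(2) \<omega>(2)] mixed by simp
  qed
  then show ?thesis
    unfolding infinitesimal_deformations_def chom_cocycles_def by blast
qed

section \<open>Equivalent deformations are cohomologous cocycles\<close>

text \<open>The right-hand side is the degree 1 coboundary of \<open>N\<close>, as a map of two arguments. It serves as
  the common form of equivalence and of being cohomologous.\<close>

definition differ_by_coboundary ::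
  "('g::ab_group_add \<Rightarrow> 'g \<Rightarrow> 'g) \<Rightarrow> ('g \<Rightarrow> 'g) \<Rightarrow> ('g list \<Rightarrow> 'g) \<Rightarrow> ('g list \<Rightarrow> 'g) \<Rightarrow> bool" where
  "differ_by_coboundary br N \<omega> \<omega>' \<longleftrightarrow>
     (\<forall>x y. \<omega> [x, y] - \<omega>' [x, y] = br x (N y) + br (N x) y - N (br x y))"

context hom_lie_algebra
begin

lemma deformed_morphism_iff:
  "(\<forall>u v. (\<lambda>(x, y). (x, y + N x)) (deformed_bracket br \<omega> u v) =
      deformed_bracket br \<omega>' ((\<lambda>(x, y). (x, y + N x)) u) ((\<lambda>(x, y). (x, y + N x)) v)) \<longleftrightarrow>
    differ_by_coboundary br N \<omega> \<omega>'"
    (is "?L \<longleftrightarrow> _")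
proof -
  have "?L \<longleftrightarrow> (\<forall>x x' y y'. br x y' + br x' y + \<omega> [x, y] + N (br x y) =
      br x (y' + N y) + br (x' + N x) y + \<omega>' [x, y])"
    unfolding split_paired_All deformed_bracket_def by simp
  also have "\<dots> \<longleftrightarrow> (\<forall>x x' y y'. \<omega> [x, y] - \<omega>' [x, y] = br x (N y) + br (N x) y - N (br x y))"
    by (intro all_cong1) (auto simp: bracket_simps algebra_simps)
  finally show ?thesis by (simp add: differ_by_coboundary_def)
qed

lemma differ_by_coboundary_iff:
  assumes "\<omega> \<in> hom_cochains scale \<alpha> 2" and "\<omega>' \<in> hom_cochains scale \<alpha> 2"
  shows "\<omega> - \<omega>' = hom_delta scale br \<alpha> 1 f \<longleftrightarrow> differ_by_coboundary br (\<lambda>x. f [x]) \<omega> \<omega>'"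
proof -
  have "\<omega> - \<omega>' = hom_delta scale br \<alpha> 1 f \<longleftrightarrow>
      (\<forall>xs\<in>{xs. length xs = 2}. (\<omega> - \<omega>') xs = hom_delta scale br \<alpha> 1 f xs)"
    using assms by (intro eq_iff_eq_on) (simp add: hom_cochains_def hom_delta_def)
  also have "\<dots> \<longleftrightarrow> differ_by_coboundary br (\<lambda>x. f [x]) \<omega> \<omega>'"
    unfolding mem_Collect_eq Ball_def all_lists_length_2_3
    by (simp add: hom_delta_1[unfolded One_nat_def] differ_by_coboundary_def)
  finally show ?thesis .
qed

end

text \<open>Linearity and compatibility with the twist of \<open>id + t N\<close> follow from those of \<open>N\<close>, so only the
  two bracket conditions remain.\<close>

lemma equivalent_deformations_iff:
  assumes "compatible_hom_lie_algebra scale br1 br2 \<alpha>"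
  shows "(\<omega>, \<omega>') \<in> equivalent_deformations scale br1 br2 \<alpha> \<longleftrightarrow>
    \<omega> \<in> chom_cocycles scale br1 br2 \<alpha> 2 \<and> \<omega>' \<in> chom_cocycles scale br1 br2 \<alpha> 2 \<and>
    (\<exists>N. module_hom scale scale N \<and> \<alpha> \<circ> N = N \<circ> \<alpha> \<and>
      differ_by_coboundary br1 N (\<omega> 1) (\<omega>' 1) \<and> differ_by_coboundary br2 N (\<omega> 2) (\<omega>' 2))"
proof -
  interpret compatible_hom_lie_algebra scale br1 br2 \<alpha> by fact
  interpret dual: module "dual_scale scale" by (rule module_dual_scale) (rule first.module_axioms)
  have lin: "module_hom (dual_scale scale) (dual_scale scale) (\<lambda>(x, y). (x, y + N x))"
    if "module_hom scale scale N" for N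
    by unfold_locales (auto simp: dual_scale_def module_hom.add[OF that] module_hom.scale[OF that]
        first.scale_right_distrib add_ac)
  have tw: "\<forall>u. (\<lambda>(x, y). (x, y + N x)) (map_prod \<alpha> \<alpha> u) =
      map_prod \<alpha> \<alpha> ((\<lambda>(x, y). (x, y + N x)) u)" if "\<alpha> \<circ> N = N \<circ> \<alpha>" for N
    using that by (auto simp: fun_eq_iff first.twist_simps)
  show ?thesis
    unfolding equivalent_deformations_def infinitesimal_deformations_eq_cocycles[OF assms]
      compatible_hom_lie_morphism_def
      mem_Collect_eq case_prod_conv first.deformed_morphism_iff second.deformed_morphism_iff
    using lin tw by meson
qed

lemma cohomologous_iff:
  assumes "compatible_hom_lie_algebra scale br1 br2 \<alpha>"
  shows "(\<omega>, \<omega>') \<in> cohomologous scale br1 br2 \<alpha> 2 \<longleftrightarrow>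
    \<omega> \<in> chom_cocycles scale br1 br2 \<alpha> 2 \<and> \<omega>' \<in> chom_cocycles scale br1 br2 \<alpha> 2 \<and>
    (\<exists>N. module_hom scale scale N \<and> \<alpha> \<circ> N = N \<circ> \<alpha> \<and>
      differ_by_coboundary br1 N (\<omega> 1) (\<omega>' 1) \<and> differ_by_coboundary br2 N (\<omega> 2) (\<omega>' 2))"
proof -
  interpret compatible_hom_lie_algebra scale br1 br2 \<alpha> by fact
  have "\<omega> - \<omega>' \<in> chom_coboundaries scale br1 br2 \<alpha> 2 \<longleftrightarrow>
    (\<exists>N. module_hom scale scale N \<and> \<alpha> \<circ> N = N \<circ> \<alpha> \<and>
      differ_by_coboundary br1 N (\<omega> 1) (\<omega>' 1) \<and> differ_by_coboundary br2 N (\<omega> 2) (\<omega>' 2))"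
    (is "?L \<longleftrightarrow> (\<exists>N. ?P N)")
    if "\<omega> \<in> chom_cochains scale \<alpha> 2" "\<omega>' \<in> chom_cochains scale \<alpha> 2"
  proof -
    have "\<omega> i \<in> hom_cochains scale \<alpha> 2" "\<omega>' i \<in> hom_cochains scale \<alpha> 2" if "i \<in> {1, 2}" for i
      using that \<open>\<omega> \<in> _\<close> \<open>\<omega>' \<in> _\<close> by (auto simp: chom_cochains_def)
    note c = this[of 1, simplified] this[of 2, simplified]
    have van: "\<omega> i = 0" "\<omega>' i = 0" if "i \<notin> {1, 2}" for i
    proof -
      have "i \<notin> {1..2}" using that by auto
      then show "\<omega> i = 0" "\<omega>' i = 0"
        using \<open>\<omega> \<in> _\<close> \<open>\<omega>' \<in> _\<close> unfolding chom_cochains_def by blast+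
    qed
    have delta: "\<omega> - \<omega>' = chom_delta scale br1 br2 \<alpha> 1 f \<longleftrightarrow>
        differ_by_coboundary br1 (\<lambda>x. f 1 [x]) (\<omega> 1) (\<omega>' 1) \<and>
        differ_by_coboundary br2 (\<lambda>x. f 1 [x]) (\<omega> 2) (\<omega>' 2)" for f
    proof -
      have "\<omega> - \<omega>' = chom_delta scale br1 br2 \<alpha> 1 f \<longleftrightarrow>
          (\<forall>i\<in>{1, 2}. (\<omega> - \<omega>') i = chom_delta scale br1 br2 \<alpha> 1 f i)"
        using van by (intro eq_iff_eq_on) (auto simp: chom_delta_def)
      also have "\<dots> \<longleftrightarrow> \<omega> 1 - \<omega>' 1 = hom_delta scale br1 \<alpha> 1 (f 1) \<and>
          \<omega> 2 - \<omega>' 2 = hom_delta scale br2 \<alpha> 1 (f 1)"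
        by (simp add: chom_delta_def)
      finally show ?thesis
        using first.differ_by_coboundary_iff[OF c(1,2)] second.differ_by_coboundary_iff[OF c(3,4)]
        by simp
    qed
    show ?thesis
    proof
      assume ?L
      then obtain f where f: "f \<in> chom_cochains scale \<alpha> 1"
        and "\<omega> - \<omega>' = chom_delta scale br1 br2 \<alpha> 1 f"
        by (auto simp: chom_coboundaries_def)
      moreover have "f 1 \<in> hom_cochains scale \<alpha> 1" using f by (simp add: chom_cochains_def)
      ultimately have "?P (\<lambda>x. f 1 [x])"
        unfolding delta hom_cochains_1_iff by (simp add: fun_eq_iff)
      then show "\<exists>N. ?P N" by blast
    next
      assume "\<exists>N. ?P N"
      then obtain N where N: "?P N" by blast
      \<comment> \<open>\<open>N\<close> as a family of 1-cochains concentrated at index 1\<close>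
      define f where "f i = (if i = 1 then (\<lambda>xs. if length xs = 1 then N (hd xs) else 0) else 0)"
        for i :: nat
      have "f 1 \<in> hom_cochains scale \<alpha> 1"
        unfolding hom_cochains_1_iff using N by (simp add: f_def fun_eq_iff)
      then have "f \<in> chom_cochains scale \<alpha> 1"
        by (simp add: chom_cochains_def f_def)
      moreover have "\<omega> - \<omega>' = chom_delta scale br1 br2 \<alpha> 1 f"
        unfolding delta using N by (simp add: f_def)
      ultimately show ?L by (simp add: chom_coboundaries_def)
    qed
  qed
  then show ?thesis by (auto simp: cohomologous_def chom_cocycles_def)
qed

text \<open>The condition on \<open>N\<close> is linear, so \<open>0\<close>, \<open>- N\<close> and \<open>M + N\<close> witness reflexivity, symmetry and
  transitivity. The inverse and the composite of the morphisms are indeed \<open>id - t N\<close> and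
  \<open>id + t (M + N)\<close>, as \<open>t\<^sup>2 = 0\<close>.\<close>

lemma equiv_equivalent_deformations:
  assumes "compatible_hom_lie_algebra scale br1 br2 \<alpha>"
  shows "equiv (chom_cocycles scale br1 br2 \<alpha> 2) (equivalent_deformations scale br1 br2 \<alpha>)"
proof -
  interpret compatible_hom_lie_algebra scale br1 br2 \<alpha> by fact
  interpret pair: module_pair scale scale by unfold_locales
  note iff = equivalent_deformations_iff[OF assms]
  note lin = first.bracket_simps second.bracket_simps first.twist_simps
    module_hom.neg[OF first.bracket_linear_left] module_hom.neg[OF first.bracket_linear_right]
    module_hom.neg[OF second.bracket_linear_left] module_hom.neg[OF second.bracket_linear_right]
    module_hom.neg[OF first.twist_linear]
  show ?thesis
  proof (rule equivI)
    show "equivalent_deformations scale br1 br2 \<alpha> \<subseteq>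
        chom_cocycles scale br1 br2 \<alpha> 2 \<times> chom_cocycles scale br1 br2 \<alpha> 2"
      by (auto simp: iff)
    show "refl_on (chom_cocycles scale br1 br2 \<alpha> 2) (equivalent_deformations scale br1 br2 \<alpha>)"
      by (intro refl_onI)
        (auto simp: iff differ_by_coboundary_def lin fun_eq_iff
          intro!: exI[of _ "\<lambda>_. 0"] pair.module_hom_zero)
    show "sym (equivalent_deformations scale br1 br2 \<alpha>)"
    proof (rule symI)
      fix \<omega> \<omega>' assume "(\<omega>, \<omega>') \<in> equivalent_deformations scale br1 br2 \<alpha>"
      then obtain N where N: "module_hom scale scale N" "\<alpha> \<circ> N = N \<circ> \<alpha>"
        "differ_by_coboundary br1 N (\<omega> 1) (\<omega>' 1)" "differ_by_coboundary br2 N (\<omega> 2) (\<omega>' 2)"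
        and co: "\<omega> \<in> chom_cocycles scale br1 br2 \<alpha> 2" "\<omega>' \<in> chom_cocycles scale br1 br2 \<alpha> 2"
        by (auto simp: iff)
      let ?N = "\<lambda>x. - N x"
      have "module_hom scale scale ?N" by (rule pair.module_hom_neg[OF N(1)])
      moreover have "\<alpha> \<circ> ?N = ?N \<circ> \<alpha>" using N(2) by (simp add: fun_eq_iff lin)
      moreover have "differ_by_coboundary br1 ?N (\<omega>' 1) (\<omega> 1)"
        "differ_by_coboundary br2 ?N (\<omega>' 2) (\<omega> 2)"
        using N(3,4) by (simp_all add: differ_by_coboundary_def lin algebra_simps)
      ultimately show "(\<omega>', \<omega>) \<in> equivalent_deformations scale br1 br2 \<alpha>"
        using co unfolding iff by blast
    qed
    show "trans (equivalent_deformations scale br1 br2 \<alpha>)"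
    proof (rule transI)
      fix \<omega> \<omega>' \<omega>''
      assume "(\<omega>, \<omega>') \<in> equivalent_deformations scale br1 br2 \<alpha>"
        and "(\<omega>', \<omega>'') \<in> equivalent_deformations scale br1 br2 \<alpha>"
      then obtain M N where N: "module_hom scale scale M" "\<alpha> \<circ> M = M \<circ> \<alpha>"
        "differ_by_coboundary br1 M (\<omega> 1) (\<omega>' 1)" "differ_by_coboundary br2 M (\<omega> 2) (\<omega>' 2)"
        "module_hom scale scale N" "\<alpha> \<circ> N = N \<circ> \<alpha>"
        "differ_by_coboundary br1 N (\<omega>' 1) (\<omega>'' 1)" "differ_by_coboundary br2 N (\<omega>' 2) (\<omega>'' 2)"
        and co: "\<omega> \<in> chom_cocycles scale br1 br2 \<alpha> 2" "\<omega>'' \<in> chom_cocycles scale br1 br2 \<alpha> 2"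
        by (auto simp: iff)
      let ?N = "\<lambda>x. M x + N x"
      have "module_hom scale scale ?N" by (rule pair.module_hom_add[OF N(1,5)])
      moreover have "\<alpha> \<circ> ?N = ?N \<circ> \<alpha>" using N(2,6) by (simp add: fun_eq_iff lin)
      moreover
      have add: "differ_by_coboundary b ?N w w''"
        if "hom_lie_algebra scale b \<alpha>"
          "differ_by_coboundary b M w w'" "differ_by_coboundary b N w' w''" for b w w' w''
        unfolding differ_by_coboundary_def
      proof (intro allI)
        fix x y
        interpret hom_lie_algebra scale b \<alpha> by fact
        have "w [x, y] - w'' [x, y] = (w [x, y] - w' [x, y]) + (w' [x, y] - w'' [x, y])" by simp
        also have "\<dots> = (b x (M y) + b (M x) y - M (b x y)) + (b x (N y) + b (N x) y - N (b x y))"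
          using that(2,3) by (simp only: differ_by_coboundary_def)
        also have "\<dots> = b x (?N y) + b (?N x) y - ?N (b x y)"
          by (simp add: bracket_simps algebra_simps)
        finally show "w [x, y] - w'' [x, y] = b x (?N y) + b (?N x) y - ?N (b x y)" .
      qed
      ultimately show "(\<omega>, \<omega>'') \<in> equivalent_deformations scale br1 br2 \<alpha>"
        using co N add[OF first.hom_lie_algebra_axioms] add[OF second.hom_lie_algebra_axioms]
        unfolding iff by blast
    qed
  qed
qed

section \<open>Classification of infinitesimal deformations\<close>

theorem theorem5p8:
  fixes scale :: "'k::field_char_0 \<Rightarrow> 'g::ab_group_add \<Rightarrow> 'g"
    and br1 br2 :: "'g \<Rightarrow> 'g \<Rightarrow> 'g" and \<alpha> :: "'g \<Rightarrow> 'g"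
  assumes "compatible_hom_lie_algebra scale br1 br2 \<alpha>"
  shows "equiv (infinitesimal_deformations scale br1 br2 \<alpha>)
      (equivalent_deformations scale br1 br2 \<alpha>) \<and>
    (\<exists>\<Phi>. bij_betw \<Phi>
        (infinitesimal_deformations scale br1 br2 \<alpha> // equivalent_deformations scale br1 br2 \<alpha>)
        (chom_cohomology scale br1 br2 \<alpha> 2) \<and>
      (\<forall>\<omega> \<in> infinitesimal_deformations scale br1 br2 \<alpha>.
        \<Phi> (equivalent_deformations scale br1 br2 \<alpha> `` {\<omega>}) =
          cohomologous scale br1 br2 \<alpha> 2 `` {\<omega>}))"
proof -
  have rel: "equivalent_deformations scale br1 br2 \<alpha> = cohomologous scale br1 br2 \<alpha> 2"
    using equivalent_deformations_iff[OF assms] cohomologous_iff[OF assms] by auto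
  show ?thesis
    using equiv_equivalent_deformations[OF assms]
    unfolding infinitesimal_deformations_eq_cocycles[OF assms] chom_cohomology_def rel
    by (intro conjI exI[of _ id]) auto
qed

end
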